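(* Let $f\in\mathbb{C}[x,y]$ be a nonzero binary form of degree $6$, and suppose that the highest multiplicity $m$ of a root of $f$ in $\mathbb{P}^1$ satisfies $m\ge 3$. Then the following hold. (1) $m=6$ if and only if $\operatorname{brank} f=1$. (2) If $m=5$, then $\operatorname{brank} f=2$. (3) If $m=4$, then $\operatorname{brank} f=3$. (4) If $m=3$, then $\operatorname{brank} f=4$. In particular, $\operatorname{rank} f-\operatorname{brank} f=0$ for $m\in\{3,6\}$, $\operatorname{rank} f-\operatorname{brank} f=4$ for $m=5$, and $\operatorname{rank} f-\operatorname{brank} f=2$ for $m=4$.
   Context: The Waring rank $\operatorname{rank} f$ of a nonzero binary form $f\in\mathbb{C}[x,y]$ of degree $d$ is the minimal $r$ such that $f=\ell_1^d+\cdots+\ell_r^d$ with $\ell_j\in\mathbb{C}[x,y]$ linear forms. The border rank $\operatorname{brank} f$ is the smallest integer $r'$ such that $f$ lies in the closure of the set of binary forms of Waring rank $r'$ in the vector space of binary forms of degree $d$. The multiplicity of a root of $f$ in $\mathbb{P}^1$ is the exact exponent of the corresponding linear factor in $f$. *)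

theory Defs
  imports "HOL-Analysis.Analysis" "HOL-Computational_Algebra.Polynomial_Factorial"
    "HOL-Computational_Algebra.Field_as_Ring"
begin

text \<open>
  The ring of polynomials over \<^typ>\<open>complex\<close> in \<open>x\<close>, \<open>y\<close> is
  \<^typ>\<open>complex poly poly\<close> with \<open>y\<close> as the outer variable: the coefficient of
  \<open>x ^ i * y ^ j\<close> in \<open>F\<close> is \<open>coeff (coeff F j) i\<close>.
\<close>

definition binary_forms :: "nat \<Rightarrow> complex poly poly set" where
  "binary_forms d = {F. \<forall>i j. coeff (coeff F j) i \<noteq> 0 \<longrightarrow> i + j = d}"

definition waring_decomposable :: "nat \<Rightarrow> complex poly poly \<Rightarrow> nat \<Rightarrow> bool" where
  "waring_decomposable d F r \<longleftrightarrow>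
     (\<exists>l :: nat \<Rightarrow> complex poly poly. (\<forall>j<r. l j \<in> binary_forms 1) \<and> F = (\<Sum>j<r. l j ^ d))"

definition waring_rank :: "nat \<Rightarrow> complex poly poly \<Rightarrow> nat" where
  "waring_rank d F = (LEAST r. waring_decomposable d F r)"

text \<open>
  The standard topology of the finite-dimensional complex vector space
  \<^term>\<open>binary_forms d\<close>, i.e. the topology of coefficientwise convergence; \<open>euclidean\<close> is the
  product topology on \<^typ>\<open>nat \<Rightarrow> nat \<Rightarrow> complex\<close>.
\<close>

definition form_topology :: "nat \<Rightarrow> complex poly poly topology" where
  "form_topology d = pullback_topology (binary_forms d) (\<lambda>F j i. coeff (coeff F j) i) euclidean"

definition border_rank :: "nat \<Rightarrow> complex poly poly \<Rightarrow> nat" where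
  "border_rank d F =
     (LEAST r. F \<in> form_topology d closure_of {G \<in> binary_forms d. G \<noteq> 0 \<and> waring_rank d G = r})"

text \<open>
  Points of the projective line are given by homogeneous coordinates \<open>(a, b) \<noteq> (0, 0)\<close>; the
  linear factor belonging to \<open>[a : b]\<close> is \<open>b * x - a * y\<close>. Neither vanishing nor the multiplicity
  depends on the chosen representative.
\<close>

definition form_eval :: "complex poly poly \<Rightarrow> complex \<Rightarrow> complex \<Rightarrow> complex" where
  "form_eval F a b = poly (poly F [:b:]) a"

definition point_factor :: "complex \<Rightarrow> complex \<Rightarrow> complex poly poly" where
  "point_factor a b = [:[:0, b:], [:- a:]:]"

definition max_root_multiplicity :: "complex poly poly \<Rightarrow> nat" where
  "max_root_multiplicity F =
     Max {multiplicity (point_factor a b) F | a b. (a, b) \<noteq> (0, 0) \<and> form_eval F a b = 0}"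

end

theory Submission
  imports Defs "HOL-Computational_Algebra.Fundamental_Theorem_Algebra"
    "Jordan_Normal_Form.Determinant"
begin

text \<open>
  Let \<open>l\<close> be the linear factor of multiplicity \<open>m\<close> in the form \<open>F\<close> of degree \<open>n\<close>, let \<open>k\<close> be a
  complementary linear form, and write \<open>F = (\<Sum>i\<le>n. (n choose i) * v i * l ^ (n - i) * k ^ i)\<close>. With
  \<open>e = n - m\<close> we have \<open>v e \<noteq> 0\<close> and \<open>v i = 0\<close> for \<open>i > e\<close>, and \<open>F\<close> is a sum of \<open>r\<close> powers iff
  \<open>v i = (\<Sum>j<r. \<alpha> j ^ (n - i) * \<beta> j ^ i)\<close> for all \<open>i\<close>. When \<open>2 * e \<le> n\<close>, the border rank is \<open>e + 1\<close>:
  the Hankel matrix \<open>(v (i + j))\<close> with \<open>i, j \<le> e\<close> is triangular and invertible, whereas it is singular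
  for sums of at most \<open>e\<close> powers, and interpolation at \<open>e + 1\<close> nodes that tend to \<open>0\<close> exhibits \<open>F\<close>
  as a limit. By apolarity, the rank is \<open>m + 1\<close> unless \<open>e = 0\<close>: there are squarefree
  operators of degree \<open>m + 1\<close> annihilating \<open>F\<close>, but none of smaller degree.
\<close>

subsection \<open>Sums of powers and apolarity\<close>

hide_const (open) Determinants.det module.smult
no_notation vec_nth (infixl "$" 90)

text \<open>This is the homogenization of \<open>p\<close> to degree \<open>n\<close>. If
  \<open>n\<close> exceeds the degree of \<open>p\<close>, the point (0, 1) becomes a root at
  infinity.\<close>

definition hom_eval :: "nat \<Rightarrow> complex poly \<Rightarrow> complex \<Rightarrow> complex \<Rightarrow> complex" where
  "hom_eval n p \<alpha> \<beta> = (\<Sum>i\<le>n. coeff p i * \<alpha> ^ (n - i) * \<beta> ^ i)"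

text \<open>The pairs may vanish, so for positive \<open>d\<close> this means at most
  \<open>r\<close> powers.\<close>

definition power_sum :: "nat \<Rightarrow> nat \<Rightarrow> (nat \<Rightarrow> complex) \<Rightarrow> bool" where
  "power_sum d r v \<longleftrightarrow> (\<exists>\<alpha> \<beta>. \<forall>i\<le>d. v i = (\<Sum>j<r. \<alpha> j ^ (d - i) * \<beta> j ^ i))"

lemma hom_eval_nonzero:
  assumes "\<alpha> \<noteq> 0" "degree p \<le> n"
  shows "hom_eval n p \<alpha> \<beta> = \<alpha> ^ n * poly p (\<beta> / \<alpha>)"
proof -
  have "poly p (\<beta> / \<alpha>) = (\<Sum>i\<le>n. coeff p i * (\<beta> / \<alpha>) ^ i)"
    unfolding poly_altdef
    by (rule sum.mono_neutral_left) (use assms in \<open>auto simp: coeff_eq_0\<close>)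
  then have "\<alpha> ^ n * poly p (\<beta> / \<alpha>) = (\<Sum>i\<le>n. \<alpha> ^ n * (coeff p i * (\<beta> / \<alpha>) ^ i))"
    by (simp add: sum_distrib_left)
  also have "\<dots> = hom_eval n p \<alpha> \<beta>"
    unfolding hom_eval_def
    by (rule sum.cong) (use assms in \<open>auto simp: power_diff power_divide\<close>)
  finally show ?thesis by simp
qed

lemma degree_prod_linear_le:
  "degree (\<Prod>j\<in>J. [:\<beta> j, - \<alpha> j:]) \<le> card J"
  for \<alpha> \<beta> :: "'a \<Rightarrow> complex"
proof (cases "finite J")
  case True
  then have "degree (\<Prod>j\<in>J. [:\<beta> j, - \<alpha> j:]) \<le> (\<Sum>j\<in>J. degree [:\<beta> j, - \<alpha> j:])"
    using degree_prod_sum_le[of J "\<lambda>j. [:\<beta> j, - \<alpha> j:]"] by (simp add: o_def)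
  also have "\<dots> \<le> (\<Sum>j\<in>J. 1)" by (rule sum_mono) simp
  finally show ?thesis by simp
qed simp

text \<open>The factor with index \<open>k\<close> vanishes at its own point. If
  \<open>\<alpha> k = 0\<close>, that factor is constant, so the product has degree below
  \<open>n\<close>, and its coefficient at \<open>n\<close>, the only one that survives at such a
  point, is zero.\<close>

lemma hom_eval_prod_linear:
  fixes \<alpha> \<beta> :: "'a \<Rightarrow> complex"
  assumes "finite J" "card J \<le> n" "k \<in> J"
  shows "hom_eval n (\<Prod>j\<in>J. [:\<beta> j, - \<alpha> j:]) (\<alpha> k) (\<beta> k) = 0"
proof (cases "\<alpha> k = 0")
  case False
  have "poly (\<Prod>j\<in>J. [:\<beta> j, - \<alpha> j:]) (\<beta> k / \<alpha> k) = 0"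
    using assms False by (auto simp: poly_prod intro!: bexI[of _ k])
  then show ?thesis
    using False assms degree_prod_linear_le[of \<beta> \<alpha> J] by (simp add: hom_eval_nonzero)
next
  case True
  have "degree (\<Prod>j\<in>J - {k}. [:\<beta> j, - \<alpha> j:]) < n"
    using card_Diff1_less[OF assms(1,3)] assms(2) degree_prod_linear_le[of \<beta> \<alpha> "J - {k}"]
    by linarith
  moreover have "(\<Prod>j\<in>J. [:\<beta> j, - \<alpha> j:]) = smult (\<beta> k) (\<Prod>j\<in>J - {k}. [:\<beta> j, - \<alpha> j:])"
    using assms True by (simp add: prod.remove)
  ultimately have "coeff (\<Prod>j\<in>J. [:\<beta> j, - \<alpha> j:]) n = 0"
    by (simp add: coeff_eq_0)
  then show ?thesis
    unfolding hom_eval_def using True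
    by (intro sum.neutral) (auto simp: power_0_left)
qed

text \<open>Apolarity: applying a differential operator of degree \<open>n\<close> to a power of a
  linear form evaluates the operator at the coefficients of that linear form. The shift
  \<open>s\<close> splits off the monomial factor.\<close>

lemma power_sum_apolar:
  assumes v: "\<And>i. i \<le> d \<Longrightarrow> v i = (\<Sum>j<r. \<alpha> j ^ (d - i) * \<beta> j ^ i)" and "s + n \<le> d"
  shows "(\<Sum>i\<le>n. coeff p i * v (i + s)) =
    (\<Sum>j<r. \<alpha> j ^ (d - n - s) * \<beta> j ^ s * hom_eval n p (\<alpha> j) (\<beta> j))"
proof -
  have "(\<Sum>i\<le>n. coeff p i * v (i + s)) =
      (\<Sum>i\<le>n. \<Sum>j<r. coeff p i * (\<alpha> j ^ (d - (i + s)) * \<beta> j ^ (i + s)))"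
    using assms by (auto simp: sum_distrib_left intro!: sum.cong)
  also have "\<dots> = (\<Sum>j<r. \<Sum>i\<le>n. coeff p i * (\<alpha> j ^ (d - (i + s)) * \<beta> j ^ (i + s)))"
    by (rule sum.swap)
  also have "\<dots> = (\<Sum>j<r. \<alpha> j ^ (d - n - s) * \<beta> j ^ s * hom_eval n p (\<alpha> j) (\<beta> j))"
    unfolding hom_eval_def sum_distrib_left
  proof (intro sum.cong refl)
    fix i j assume "i \<in> {..n}"
    then have "d - (i + s) = (d - n - s) + (n - i)" using assms(2) by auto
    then show "coeff p i * (\<alpha> j ^ (d - (i + s)) * \<beta> j ^ (i + s)) =
        \<alpha> j ^ (d - n - s) * \<beta> j ^ s * (coeff p i * \<alpha> j ^ (n - i) * \<beta> j ^ i)"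
      by (simp add: power_add)
  qed
  finally show ?thesis .
qed

text \<open>Pad with zero pairs. Positivity of \<open>d\<close> ensures that
  \<open>0 ^ (d - i) * 0 ^ i\<close> is 0 and not 1.\<close>

lemma power_sum_mono:
  assumes "power_sum d r v" "r \<le> r'" "d > 0"
  shows "power_sum d r' v"
proof -
  obtain \<alpha> \<beta> where v: "\<And>i. i \<le> d \<Longrightarrow> v i = (\<Sum>j<r. \<alpha> j ^ (d - i) * \<beta> j ^ i)"
    using assms unfolding power_sum_def by blast
  have "v i = (\<Sum>j<r'. (if j < r then \<alpha> j else 0) ^ (d - i) * (if j < r then \<beta> j else 0) ^ i)"
    if "i \<le> d" for i
    unfolding v[OF that]
  proof (rule sum.mono_neutral_cong_left)
    show "\<forall>j\<in>{..<r'} - {..<r}. (if j < r then \<alpha> j else 0) ^ (d - i) * (if j < r then \<beta> j else 0) ^ i = 0"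
      using assms that by (auto simp: power_0_left)
  qed (use assms in auto)
  then show ?thesis unfolding power_sum_def
    by (intro exI[of _ "\<lambda>j. if j < r then \<alpha> j else 0"]
        exI[of _ "\<lambda>j. if j < r then \<beta> j else 0"] allI impI)
qed

text \<open>The operator \<open>Y ^ e * (\<Prod>j. \<beta> j * X - \<alpha> j * Y)\<close>, where \<open>j\<close> ranges over the summands with
  \<open>\<beta> j \<noteq> 0\<close>, annihilates the sum of powers, but only its \<open>Y ^ e\<close>-coefficient meets \<open>v\<close>.\<close>
lemma power_sum_lower_bound:
  assumes "power_sum d r v" "0 < e" "e \<le> d" "v e \<noteq> 0"
    and zero: "\<And>i. e < i \<Longrightarrow> i \<le> d \<Longrightarrow> v i = 0"
  shows "d - e < r"
proof (rule ccontr)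
  assume "\<not> d - e < r"
  obtain \<alpha> \<beta> where v: "\<And>i. i \<le> d \<Longrightarrow> v i = (\<Sum>j<r. \<alpha> j ^ (d - i) * \<beta> j ^ i)"
    using assms unfolding power_sum_def by blast
  \<comment> \<open>Leaving out the indices with \<open>\<beta> j = 0\<close> keeps the constant
    coefficient of \<open>h\<close> nonzero; those summands are killed by the factor
    \<open>\<beta> j ^ e\<close>, as \<open>0 < e\<close>.\<close>
  define J where "J = {j. j < r \<and> \<beta> j \<noteq> 0}"
  define h where "h = (\<Prod>j\<in>J. [:\<beta> j, - \<alpha> j:])"
  have "J \<subseteq> {..<r}" by (auto simp: J_def)
  with \<open>\<not> d - e < r\<close> card_mono[OF _ this] have J: "finite J" "card J \<le> d - e"
    by (auto intro: finite_subset)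
  have "(\<Sum>i\<le>d - e. coeff h i * v (i + e)) =
      (\<Sum>j<r. \<alpha> j ^ (d - (d - e) - e) * \<beta> j ^ e * hom_eval (d - e) h (\<alpha> j) (\<beta> j))"
    by (rule power_sum_apolar[OF v]) (use assms in auto)
  also have "\<dots> = 0"
  proof (rule sum.neutral, rule ballI)
    fix j assume "j \<in> {..<r}"
    then show "\<alpha> j ^ (d - (d - e) - e) * \<beta> j ^ e * hom_eval (d - e) h (\<alpha> j) (\<beta> j) = 0"
      using J hom_eval_prod_linear[of J "d - e" j \<beta> \<alpha>] \<open>0 < e\<close>
      by (cases "\<beta> j = 0") (auto simp: h_def J_def)
  qed
  also have "(\<Sum>i\<le>d - e. coeff h i * v (i + e)) = (\<Sum>i\<in>{0}. coeff h i * v (i + e))"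
    by (rule sum.mono_neutral_right) (use assms in auto)
  finally have "coeff h 0 = 0" using \<open>v e \<noteq> 0\<close> by simp
  moreover have "coeff h 0 = (\<Prod>j\<in>J. \<beta> j)"
    by (simp add: h_def poly_prod flip: poly_0_coeff_0)
  ultimately show False using J by (auto simp: J_def)
qed

section \<open>Hankel determinants as equations for sums of few powers\<close>

text \<open>A minor of a catalecticant matrix of the form: a polynomial in \<open>v\<close>, so that
  its vanishing passes to limits.\<close>

definition hankel_det :: "nat \<Rightarrow> (nat \<Rightarrow> complex) \<Rightarrow> complex" where
  "hankel_det n v = det (mat n n (\<lambda>(i, j). v (i + j)))"

text \<open>A kernel vector \<open>q\<close> is read as the coefficients of an operator of degree
  below \<open>n\<close> that annihilates \<open>v\<close> at every shift.\<close>

lemma hankel_det_eq_0_iff: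
  "hankel_det n v = 0 \<longleftrightarrow> (\<exists>q. (\<exists>i<n. q i \<noteq> 0) \<and> (\<forall>s<n. (\<Sum>i<n. q i * v (i + s)) = 0))"
  (is "_ \<longleftrightarrow> ?R")
proof -
  let ?A = "mat n n (\<lambda>(i, j). v (i + j))"
  have mult: "(?A *\<^sub>v vec n q = 0\<^sub>v n) \<longleftrightarrow> (\<forall>s<n. (\<Sum>i<n. q i * v (i + s)) = 0)" for q
    by (auto simp: vec_eq_iff scalar_prod_def lessThan_atLeast0 add.commute mult.commute)
  have nz: "vec n q \<noteq> 0\<^sub>v n \<longleftrightarrow> (\<exists>i<n. q i \<noteq> 0)" for q :: "nat \<Rightarrow> complex"
    by (auto simp: vec_eq_iff)
  have "hankel_det n v = 0 \<longleftrightarrow> (\<exists>w. w \<in> carrier_vec n \<and> w \<noteq> 0\<^sub>v n \<and> ?A *\<^sub>v w = 0\<^sub>v n)"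
    unfolding hankel_det_def by (rule det_0_iff_vec_prod_zero) simp
  also have "\<dots> \<longleftrightarrow> (\<exists>q. vec n q \<noteq> 0\<^sub>v n \<and> ?A *\<^sub>v vec n q = 0\<^sub>v n)"
  proof
    assume "\<exists>w. w \<in> carrier_vec n \<and> w \<noteq> 0\<^sub>v n \<and> ?A *\<^sub>v w = 0\<^sub>v n"
    then obtain w where w: "w \<in> carrier_vec n" "w \<noteq> 0\<^sub>v n" "?A *\<^sub>v w = 0\<^sub>v n" by blast
    have "vec n (\<lambda>i. w $ i) = w" using w(1) by auto
    with w show "\<exists>q. vec n q \<noteq> 0\<^sub>v n \<and> ?A *\<^sub>v vec n q = 0\<^sub>v n" by metis
  qed (use vec_carrier in blast)
  finally show ?thesis unfolding mult nz .
qed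

text \<open>The product of the linear factors vanishing at the points has degree at most
  \<open>e\<close> and supplies the kernel vector; \<open>2 * e \<le> d\<close> keeps all shifts up
  to \<open>e\<close> within range.\<close>

lemma hankel_det_power_sum:
  assumes "power_sum d r v" "r \<le> e" "2 * e \<le> d"
  shows "hankel_det (Suc e) v = 0"
proof -
  obtain \<alpha> \<beta> where v: "\<And>i. i \<le> d \<Longrightarrow> v i = (\<Sum>j<r. \<alpha> j ^ (d - i) * \<beta> j ^ i)"
    using assms unfolding power_sum_def by blast
  \<comment> \<open>A zero pair would make the product \<open>h\<close> zero, hence useless as a
    kernel vector.\<close>
  define J where "J = {j. j < r \<and> (\<alpha> j, \<beta> j) \<noteq> (0, 0)}"
  define h where "h = (\<Prod>j\<in>J. [:\<beta> j, - \<alpha> j:])"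
  have "J \<subseteq> {..<r}" by (auto simp: J_def)
  with \<open>r \<le> e\<close> card_mono[OF _ this] have J: "finite J" "card J \<le> e"
    by (auto intro: finite_subset)
  have "h \<noteq> 0" using J by (auto simp: h_def J_def)
  moreover have "degree h \<le> e"
    using J degree_prod_linear_le[of \<beta> \<alpha> J] by (simp add: h_def)
  ultimately have "\<exists>i<Suc e. coeff h i \<noteq> 0"
    by (metis leading_coeff_neq_0 less_Suc_eq_le)
  moreover have "(\<Sum>i<Suc e. coeff h i * v (i + s)) = 0" if "s < Suc e" for s
  proof -
    have "(\<Sum>i\<le>e. coeff h i * v (i + s)) =
        (\<Sum>j<r. \<alpha> j ^ (d - e - s) * \<beta> j ^ s * hom_eval e h (\<alpha> j) (\<beta> j))"
      by (rule power_sum_apolar[OF v]) (use assms that in auto)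
    also have "\<dots> = 0"
    proof (rule sum.neutral, rule ballI)
      fix j assume j: "j \<in> {..<r}"
      have "hom_eval e h (\<alpha> j) (\<beta> j) = 0"
      proof (cases "j \<in> J")
        case True
        then show ?thesis using J hom_eval_prod_linear[of J e j \<beta> \<alpha>] by (simp add: h_def)
      next
        case False
        then show ?thesis using j assms unfolding hom_eval_def
          by (intro sum.neutral) (auto simp: J_def power_0_left)
      qed
      then show "\<alpha> j ^ (d - e - s) * \<beta> j ^ s * hom_eval e h (\<alpha> j) (\<beta> j) = 0" by simp
    qed
    finally show ?thesis by (simp add: lessThan_Suc_atMost)
  qed
  ultimately show ?thesis unfolding hankel_det_eq_0_iff by blast
qed

lemma hankel_det_triangular:
  assumes "v e \<noteq> 0" and zero: "\<And>i. e < i \<Longrightarrow> i \<le> 2 * e \<Longrightarrow> v i = 0"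
  shows "hankel_det (Suc e) v \<noteq> 0"
proof
  assume "hankel_det (Suc e) v = 0"
  then obtain q where q: "\<exists>i<Suc e. q i \<noteq> 0" "\<And>s. s < Suc e \<Longrightarrow> (\<Sum>i<Suc e. q i * v (i + s)) = 0"
    unfolding hankel_det_eq_0_iff by blast
  have "q k = 0" if "k \<le> e" for k
    using that
  proof (induction k rule: less_induct)
    case (less k)
    \<comment> \<open>In the equation with shift \<open>e - k\<close>, terms with
      \<open>i < k\<close> vanish by induction and terms with \<open>i > k\<close> meet
      \<open>v\<close> beyond \<open>e\<close>, which leaves \<open>q k * v e = 0\<close>.\<close>
    have "q i * v (i + (e - k)) = 0" if "i < Suc e" "i \<noteq> k" for i
      using less that zero[of "i + (e - k)"] by (cases "i < k") auto
    then have "(\<Sum>i<Suc e. q i * v (i + (e - k))) = (\<Sum>i\<in>{k}. q i * v (i + (e - k)))"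
      by (intro sum.mono_neutral_right) (use less in auto)
    then show ?case using q(2)[of "e - k"] less assms(1) by simp
  qed
  then show False using q(1) by (auto simp: less_Suc_eq_le)
qed

lemma continuous_on_hankel_det:
  fixes g :: "'a :: topological_space \<Rightarrow> nat \<Rightarrow> complex"
  assumes "\<And>i. continuous_on UNIV (\<lambda>x. g x i)"
  shows "continuous_on UNIV (\<lambda>x. hankel_det n (g x))"
proof -
  have "hankel_det n (g x) = (\<Sum>p | p permutes {0..<n}. signof p * (\<Prod>i = 0..<n. g x (i + p i)))" for x
    unfolding hankel_det_def det_def'[OF mat_carrier]
    by (intro sum.cong arg_cong2[where f = "(*)"] prod.cong refl) (auto simp: permutes_in_image)
  then show ?thesis by (auto intro!: continuous_intros assms)
qed

subsection \<open>Interpolation\<close>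

text \<open>Division by the node polynomial, with the remainder written in the Lagrange basis.
  \<open>L\<close> is fixed before \<open>p\<close>, so that the values of a linear functional on
  \<open>L z\<close> can serve as weights at the nodes.\<close>

lemma lagrange_interpolation:
  fixes Z :: "'a :: field set"
  assumes "finite Z"
  obtains L where "\<And>p. \<exists>u. p = (\<Sum>z\<in>Z. smult (poly p z) (L z)) + (\<Prod>z\<in>Z. [:- z, 1:]) * u \<and>
    (u \<noteq> 0 \<longrightarrow> card Z + degree u \<le> degree p)"
proof
  let ?Q = "\<lambda>Y. \<Prod>z\<in>Y. [:- z, 1:]"
  define L where "L = (\<lambda>z. smult (inverse (\<Prod>y\<in>Z - {z}. z - y)) (?Q (Z - {z})))"
  have deg: "degree (?Q Y) = card Y" for Y :: "'a set"
    by (subst degree_prod_eq_sum_degree) auto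
  have L: "poly (L z) x = (if z = x then 1 else 0)" if "z \<in> Z" "x \<in> Z" for z x
    using that assms by (auto simp: L_def poly_prod)
  have root_dvd: "?Q Y dvd p" if "\<forall>z\<in>Y. poly p z = 0" for p and Y :: "'a set"
  proof (cases "finite Y")
    case True
    then show ?thesis using that
    proof (induction Y arbitrary: p)
      case (insert y Y)
      from insert.prems obtain q where q: "p = [:- y, 1:] * q"
        unfolding poly_eq_0_iff_dvd by blast
      have "\<forall>z\<in>Y. poly q z = 0" using insert.prems insert.hyps q by auto
      then have "?Q Y dvd q" by (rule insert.IH)
      then show ?case using insert.hyps unfolding q by (simp add: mult_dvd_mono del: mult_pCons_left)
    qed simp
  qed simp
  show "\<exists>u. p = (\<Sum>z\<in>Z. smult (poly p z) (L z)) + ?Q Z * u \<and>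
    (u \<noteq> 0 \<longrightarrow> card Z + degree u \<le> degree p)" for p
  proof -
    let ?S = "\<Sum>z\<in>Z. smult (poly p z) (L z)"
    have "poly (p - ?S) x = 0" if "x \<in> Z" for x
    proof -
      have "(\<Sum>z\<in>Z. poly p z * poly (L z) x) = (\<Sum>z\<in>Z. if z = x then poly p x else 0)"
        by (rule sum.cong) (auto simp: L that)
      then show ?thesis using that assms by (simp add: poly_sum)
    qed
    then obtain u where u: "p - ?S = ?Q Z * u" using root_dvd by (meson dvdE)
    have "card Z + degree u \<le> degree p" if "u \<noteq> 0"
    proof (rule ccontr)
      assume less: "\<not> card Z + degree u \<le> degree p"
      have "?Q Z \<noteq> 0" using assms by auto
      then have D: "degree (p - ?S) = card Z + degree u"
        unfolding u using that by (simp add: degree_mult_eq deg)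
      have "degree (smult (poly p z) (L z)) \<le> card Z - 1" if "z \<in> Z" for z
      proof -
        have "degree (smult (poly p z) (L z)) \<le> degree (?Q (Z - {z}))"
          by (simp add: L_def)
        also have "\<dots> = card Z - 1"
          unfolding deg using assms that by simp
        finally show ?thesis .
      qed
      then have "degree ?S \<le> card Z - 1" by (intro degree_sum_le assms)
      \<comment> \<open>The interpolant has degree below the number of nodes, so a nonzero multiple
        of the node polynomial can only arise from \<open>p\<close> itself.\<close>
      then have "degree (p - ?S) \<le> max (degree p) (card Z - 1)"
        using degree_diff_le_max[of p ?S] by linarith
      with less show False unfolding D by (auto simp: max_def split: if_splits)
    qed
    moreover from u have "p = ?S + ?Q Z * u" by (simp add: algebra_simps)
    ultimately show ?thesis by blast
  qed
qed

lemma moment_problem: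
  fixes Z :: "'a :: field set"
  assumes "finite Z"
  obtains w where "\<And>i. i < card Z \<Longrightarrow> (\<Sum>z\<in>Z. w z * z ^ i) = v i"
proof -
  obtain L where L: "\<And>P. \<exists>u. P = (\<Sum>z\<in>Z. smult (poly P z) (L z)) + (\<Prod>z\<in>Z. [:- z, 1:]) * u \<and>
    (u \<noteq> 0 \<longrightarrow> card Z + degree u \<le> degree P)"
    using lagrange_interpolation[OF assms] by metis
  \<comment> \<open>The weight at \<open>z\<close> is the value on \<open>L z\<close> of the
    functional sending \<open>t ^ j\<close> to \<open>v j\<close>. Below degree
    \<open>card Z\<close> interpolation is exact, so the functional can be applied to
    \<open>t ^ i\<close> written in the basis.\<close>
  have "(\<Sum>z\<in>Z. (\<Sum>j<card Z. coeff (L z) j * v j) * z ^ i) = v i" if "i < card Z" for i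
  proof -
    obtain u where u: "monom 1 i = (\<Sum>z\<in>Z. smult (poly (monom 1 i) z) (L z)) + (\<Prod>z\<in>Z. [:- z, 1:]) * u"
      "u \<noteq> 0 \<longrightarrow> card Z + degree u \<le> degree (monom (1 :: 'a) i)"
      using L[of "monom 1 i"] by blast
    have "u = 0" using u(2) that by (auto simp: degree_monom_eq)
    with u(1) have L: "monom 1 i = (\<Sum>z\<in>Z. smult (z ^ i) (L z))"
      by (simp add: poly_monom)
    have "(\<Sum>z\<in>Z. (\<Sum>j<card Z. coeff (L z) j * v j) * z ^ i) =
        (\<Sum>j<card Z. v j * coeff (\<Sum>z\<in>Z. smult (z ^ i) (L z)) j)"
      unfolding coeff_sum coeff_smult sum_distrib_right sum_distrib_left
      by (subst sum.swap) (simp add: mult_ac)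
    also have "\<dots> = (\<Sum>j<card Z. if i = j then v j else 0)"
      unfolding L[symmetric] by (intro sum.cong) auto
    finally show ?thesis using that by simp
  qed
  then show ?thesis by (rule that)
qed

section \<open>From weighted nodes to sums of powers\<close>

text \<open>A weight is absorbed by its \<open>d\<close>-th root \<open>c\<close>: the node
  \<open>z\<close> becomes the pair \<open>(c, c * z)\<close>.\<close>

lemma power_sum_of_weights:
  assumes "finite Z" "d > 0" "\<And>i. i \<le> d \<Longrightarrow> v i = (\<Sum>z\<in>Z. w z * z ^ i)"
  shows "power_sum d (card Z) v"
proof -
  have "\<exists>c. c ^ d = w z" for z
    using exists_complex_root[of d "w z"] \<open>d > 0\<close> by (metis less_numeral_extra(3))
  then obtain c where c: "\<And>z. c z ^ d = w z" by metis
  obtain h where h: "bij_betw h {..<card Z} Z"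
    using ex_bij_betw_nat_finite[OF assms(1)] by (auto simp: atLeast0LessThan)
  have "v i = (\<Sum>j<card Z. c (h j) ^ (d - i) * (c (h j) * h j) ^ i)" if "i \<le> d" for i
  proof -
    have "c z ^ (d - i) * (c z * z) ^ i = w z * z ^ i" for z
      using that by (simp add: c[symmetric] power_mult_distrib mult.assoc[symmetric] flip: power_add)
    then show ?thesis
      unfolding assms(3)[OF that] by (simp add: sum.reindex_bij_betw[OF h, of "\<lambda>z. w z * z ^ i"])
  qed
  then show ?thesis unfolding power_sum_def
    by (intro exI[of _ "\<lambda>j. c (h j)"] exI[of _ "\<lambda>j. c (h j) * h j"] allI impI)
qed

text \<open>This guarantees that the minimum defining the Waring rank is attained.\<close>

lemma power_sum_exists:
  assumes "d > 0"
  shows "power_sum d (Suc d) v"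
proof -
  define Z :: "complex set" where "Z = of_nat ` {..d}"
  have Z: "finite Z" and cardZ: "card Z = Suc d"
    by (simp_all add: Z_def card_image inj_on_def)
  obtain w where "\<And>i. i < card Z \<Longrightarrow> (\<Sum>z\<in>Z. w z * z ^ i) = v i"
    using moment_problem[OF Z] by metis
  then show ?thesis
    using power_sum_of_weights[OF Z assms, of v w] by (simp add: cardZ)
qed

text \<open>At a multiple root \<open>x\<close>, both \<open>p\<close> and \<open>t * p'\<close> are
  determined by \<open>c * x ^ n\<close>; eliminating \<open>c\<close> makes \<open>x\<close> a root
  of \<open>r = t * p' - n * p\<close>, which is nonzero at 0. Each of the finitely many roots of
  \<open>r\<close> excludes a single value of \<open>c\<close>.\<close>

lemma rsquarefree_add_monom:
  fixes p :: "complex poly"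
  assumes "poly p 0 \<noteq> 0" "degree p < n"
  obtains c where "c \<noteq> 0" "rsquarefree (p + monom c n)"
proof -
  define r where "r = pCons 0 (pderiv p) - smult (of_nat n) p"
  have "poly r 0 \<noteq> 0" using assms by (simp add: r_def)
  then have "r \<noteq> 0" by auto
  then have "finite ({0} \<union> (\<lambda>x. - poly p x / x ^ n) ` {x. poly r x = 0})"
    by (simp add: poly_roots_finite)
  then obtain c where c: "c \<noteq> 0" "\<And>x. poly r x = 0 \<Longrightarrow> c \<noteq> - poly p x / x ^ n"
    using ex_new_if_finite[OF infinite_UNIV_char_0] by blast
  have "rsquarefree (p + monom c n)"
    unfolding rsquarefree_roots
  proof (intro allI notI, elim conjE)
    fix x assume x: "poly (p + monom c n) x = 0" "poly (pderiv (p + monom c n)) x = 0"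
    have "x \<noteq> 0" using x(1) assms by (auto simp: poly_monom power_0_left)
    have "poly p x = - (c * x ^ n)" using x(1) by (simp add: poly_monom eq_neg_iff_add_eq_0)
    moreover have "x * poly (pderiv p) x = - (of_nat n * c * x ^ n)"
    proof -
      have "poly (pderiv p) x = - (of_nat n * c * x ^ (n - 1))"
        using x(2) by (simp add: pderiv_add pderiv_monom poly_monom eq_neg_iff_add_eq_0)
      moreover have "x ^ n = x * x ^ (n - 1)" using assms(2) by (cases n) auto
      ultimately show ?thesis by simp
    qed
    ultimately have "poly r x = 0" by (simp add: r_def)
    then show False using c(2)[of x] \<open>poly p x = _\<close> \<open>x \<noteq> 0\<close> by simp
  qed
  with c(1) show ?thesis by (rule that)
qed

text \<open>The functional \<open>\<Lambda>\<close> sending \<open>t ^ i\<close> to \<open>v i\<close> annihilates the multiples of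
  \<open>p + c * t ^ (d + 1 - e)\<close> when \<open>p\<close> is the truncated inverse of \<open>v e + v (e - 1) * t + \<dots>\<close>;
  choosing \<open>c\<close> such that the roots are simple, \<open>\<Lambda>\<close> is a combination of evaluations at them.\<close>
lemma power_sum_upper_bound:
  assumes "2 * e \<le> d" "d > 0" "v e \<noteq> 0"
    and zero: "\<And>i. e < i \<Longrightarrow> i \<le> d \<Longrightarrow> v i = 0"
  shows "power_sum d (Suc d - e) v"
proof -
  define B :: "complex fps" where "B = Abs_fps (\<lambda>j. if j \<le> e then v (e - j) else 0)"
  define p where "p = (\<Sum>i\<le>e. monom (fps_nth (inverse B) i) i)"
  have coeff_p: "coeff p i = (if i \<le> e then fps_nth (inverse B) i else 0)" for i
    by (simp add: p_def coeff_sum)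
  have "fps_nth B 0 \<noteq> 0" using assms by (simp add: B_def)
  \<comment> \<open>From \<open>2 * e \<le> d\<close>: the truncation at degree \<open>e\<close>
    stays below the added monomial.\<close>
  have degp: "degree p < Suc d - e"
    using assms(1) coeff_p by (intro le_less_trans[OF degree_le[of e]]) auto
  have "poly p 0 \<noteq> 0"
    using \<open>fps_nth B 0 \<noteq> 0\<close> by (simp add: poly_0_coeff_0 coeff_p)
  then obtain c where c: "c \<noteq> 0" "rsquarefree (p + monom c (Suc d - e))"
    using rsquarefree_add_monom degp by blast
  define q where "q = p + monom c (Suc d - e)"
  have q: "coeff q i = coeff p i" if "i \<le> d - e" for i
    using that assms(1) by (simp add: q_def)
  have degq: "degree q = Suc d - e" and lcq: "lead_coeff q = c"
    using degp c
    by (simp_all add: q_def degree_add_eq_right degree_monom_eq lead_coeff_add_le lead_coeff_monom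
        coeff_eq_0)
  define Z where "Z = {z. poly q z = 0}"
  have decomp: "smult c (\<Prod>z\<in>Z. [:- z, 1:]) = q"
    using complex_poly_decompose_rsquarefree[of q] c(2) lcq unfolding Z_def q_def by simp
  have "q \<noteq> 0" using lcq c by auto
  then have Z: "finite Z" by (simp add: Z_def poly_roots_finite)
  have cardZ: "card Z = Suc d - e"
    using degq c unfolding decomp[symmetric]
    by (subst (asm) degree_smult_eq, subst (asm) degree_prod_eq_sum_degree) auto
  define \<Lambda> where "\<Lambda> = (\<lambda>P. \<Sum>i\<le>d. coeff P i * v i)"
  have add: "\<Lambda> (P + R) = \<Lambda> P + \<Lambda> R" for P R
    by (simp add: \<Lambda>_def algebra_simps sum.distrib)
  have smult: "\<Lambda> (smult a P) = a * \<Lambda> P" for a P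
    by (simp add: \<Lambda>_def sum_distrib_left mult.assoc)
  have sum: "\<Lambda> (\<Sum>x\<in>A. g x) = (\<Sum>x\<in>A. \<Lambda> (g x))" for g and A :: "'b set"
    by (induction A rule: infinite_finite_induct) (auto simp: add, simp_all add: \<Lambda>_def)
  have shift: "\<Lambda> (q * monom 1 s) = 0" if s: "s < e" for s
  proof -
    have "\<Lambda> (q * monom 1 s) = (\<Sum>i\<in>{s..e}. coeff (q * monom 1 s) i * v i)"
      unfolding \<Lambda>_def
      by (rule sum.mono_neutral_right) (use assms(1) zero in \<open>auto simp: coeff_monom_mult mult.commute[of q]\<close>)
    \<comment> \<open>Only exponents up to \<open>e\<close> matter, and the monomial with
      coefficient \<open>c\<close> lies beyond them. The sum is then the coefficient of
      \<open>t ^ (e - s)\<close> in \<open>inverse B * B = 1\<close>, which is zero as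
      \<open>s < e\<close>.\<close>
    also have "\<dots> = (\<Sum>i\<in>{s..e}. fps_nth (inverse B) (i - s) * v i)"
      using assms(1) by (intro sum.cong refl) (auto simp: mult.commute[of q] coeff_monom_mult q coeff_p split: if_splits)
    also have "\<dots> = (\<Sum>i\<in>{0..e - s}. fps_nth (inverse B) i * fps_nth B (e - s - i))"
      by (rule sum.reindex_bij_witness[of _ "\<lambda>i. i + s" "\<lambda>i. i - s"]) (use s in \<open>auto simp: B_def\<close>)
    also have "\<dots> = fps_nth (inverse B * B) (e - s)"
      by (simp add: fps_mult_nth)
    also have "\<dots> = 0"
      using s \<open>fps_nth B 0 \<noteq> 0\<close> by (simp add: inverse_mult_eq_1)
    finally show ?thesis .
  qed
  have ideal: "\<Lambda> (q * u) = 0" if "u \<noteq> 0 \<longrightarrow> degree u < e" for u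
  proof (cases "u = 0")
    case False
    have "q * u = (\<Sum>s\<le>degree u. smult (coeff u s) (q * monom 1 s))"
      by (subst poly_as_sum_of_monoms[of u, symmetric])
        (simp add: sum_distrib_left smult_monom flip: mult_smult_right)
    also have "\<Lambda> \<dots> = 0"
      using that False unfolding sum by (intro sum.neutral) (auto simp: smult shift)
    finally show ?thesis .
  qed (simp add: \<Lambda>_def)
  obtain L where L: "\<And>P. \<exists>u. P = (\<Sum>z\<in>Z. smult (poly P z) (L z)) + (\<Prod>z\<in>Z. [:- z, 1:]) * u \<and>
    (u \<noteq> 0 \<longrightarrow> card Z + degree u \<le> degree P)"
    using lagrange_interpolation[OF Z] by metis
  have "v i = (\<Sum>z\<in>Z. \<Lambda> (L z) * z ^ i)" if i: "i \<le> d" for i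
  proof -
    obtain u where u: "monom 1 i = (\<Sum>z\<in>Z. smult (poly (monom 1 i) z) (L z)) + (\<Prod>z\<in>Z. [:- z, 1:]) * u"
      "u \<noteq> 0 \<longrightarrow> card Z + degree u \<le> degree (monom (1 :: complex) i)"
      using L[of "monom 1 i"] by blast
    have "(\<Prod>z\<in>Z. [:- z, 1:]) * u = q * smult (inverse c) u"
      using c(1) by (simp add: decomp[symmetric])
    \<comment> \<open>Since \<open>i \<le> d\<close> and there are \<open>d + 1 - e\<close> nodes, a
      nonzero quotient \<open>u\<close> has degree at most \<open>e - 1\<close>, within reach of
      \<open>ideal\<close>.\<close>
    moreover have "\<Lambda> (q * smult (inverse c) u) = 0"
      using u(2) i cardZ assms(1) by (intro ideal) (auto simp: degree_monom_eq)
    ultimately have "\<Lambda> (monom 1 i) = (\<Sum>z\<in>Z. \<Lambda> (L z) * z ^ i)"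
      by (subst u(1)) (simp add: add sum smult poly_monom mult.commute)
    moreover have "\<Lambda> (monom 1 i) = v i"
      using i by (simp add: \<Lambda>_def if_distrib[of "\<lambda>x. x * _"] cong: if_cong)
    ultimately show ?thesis by simp
  qed
  from power_sum_of_weights[OF Z assms(2) this] show ?thesis by (simp add: cardZ)
qed

text \<open>Interpolating \<open>v\<close> at the nodes \<open>0, \<epsilon>, \<dots>, e * \<epsilon>\<close> reproduces \<open>v 0, \<dots>, v e\<close> exactly and
  makes the higher terms of order \<open>\<epsilon>\<close>.\<close>
lemma power_sum_degeneration:
  assumes "d > 0" and zero: "\<And>i. e < i \<Longrightarrow> i \<le> d \<Longrightarrow> v i = 0"
  obtains g :: "complex \<Rightarrow> nat \<Rightarrow> complex" where
    "\<And>i. continuous_on UNIV (\<lambda>t. g t i)" "\<And>i. i \<le> d \<Longrightarrow> g 0 i = v i"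
    "\<And>t. t \<noteq> 0 \<Longrightarrow> power_sum d (Suc e) (g t)"
proof -
  define Z :: "complex set" where "Z = of_nat ` {..e}"
  have Z: "finite Z" and cardZ: "card Z = Suc e"
    by (simp_all add: Z_def card_image inj_on_def)
  have "\<exists>w. \<forall>i<card Z. (\<Sum>z\<in>Z. w z * z ^ i) = (if i = j then 1 else 0)" for j
    using moment_problem[OF Z, of "\<lambda>i. if i = j then 1 else 0"] by metis
  then obtain L where L: "\<And>j i. i \<le> e \<Longrightarrow> (\<Sum>z\<in>Z. L j z * z ^ i) = (if i = j then 1 else 0)"
    unfolding cardZ less_Suc_eq_le by metis
  define M where "M = (\<lambda>i j. \<Sum>z\<in>Z. L j z * z ^ i)"
  \<comment> \<open>For \<open>i \<le> e\<close>, \<open>M i j\<close> is the Kronecker delta and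
    the interpolated value is \<open>v i\<close>. For \<open>i > e\<close> every exponent
    \<open>i - j\<close> is positive, so \<open>g\<close> is polynomial in \<open>t\<close> and
    vanishes at 0.\<close>
  define g where "g = (\<lambda>t i. if i \<le> e then v i else (\<Sum>j\<le>e. v j * t ^ (i - j) * M i j))"
  show thesis
  proof
    show "continuous_on UNIV (\<lambda>t. g t i)" for i
      by (cases "i \<le> e") (auto simp: g_def intro!: continuous_intros)
    show "g 0 i = v i" if "i \<le> d" for i
      using that zero by (auto simp: g_def intro!: sum.neutral)
    show "power_sum d (Suc e) (g t)" if "t \<noteq> 0" for t
    proof -
      \<comment> \<open>The weights at the scaled nodes \<open>t * z\<close>: dividing by
        \<open>t ^ j\<close> undoes the scaling of the \<open>j\<close>-th moment.\<close>
      define w where "w = (\<lambda>z. \<Sum>j\<le>e. L j z * v j / t ^ j)"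
      have g: "g t i = (\<Sum>z\<in>Z. w z * (t * z) ^ i)" for i
      proof -
        have "(\<Sum>z\<in>Z. w z * (t * z) ^ i) = (\<Sum>z\<in>Z. \<Sum>j\<le>e. v j * t ^ i / t ^ j * (L j z * z ^ i))"
          unfolding w_def sum_distrib_right
          by (intro sum.cong refl) (simp add: power_mult_distrib)
        also have "\<dots> = (\<Sum>j\<le>e. v j * t ^ i / t ^ j * M i j)"
          unfolding M_def sum_distrib_left by (rule sum.swap)
        also have "\<dots> = g t i"
        proof (cases "i \<le> e")
          case True
          then show ?thesis using that by (simp add: g_def M_def L if_distrib[of "\<lambda>x. _ * x"] cong: if_cong)
        next
          case False
          then show ?thesis using that by (auto simp: g_def power_diff intro!: sum.cong)
        qed
        finally show ?thesis by simp
      qed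
      have "inj_on ((*) t) Z" using that by (simp add: inj_on_def)
      then have "power_sum d (card ((*) t ` Z)) (g t)"
        using Z assms(1) that
        by (intro power_sum_of_weights[where w = "\<lambda>z. w (z / t)"]) (auto simp: g sum.reindex)
      with \<open>inj_on ((*) t) Z\<close> show ?thesis by (simp add: card_image cardZ)
    qed
  qed
qed

subsection \<open>Binary forms in adapted coordinates\<close>

lemma form_eval_simps [simp]:
  "form_eval 0 x y = 0"
  "form_eval (F + G) x y = form_eval F x y + form_eval G x y"
  "form_eval (F * G) x y = form_eval F x y * form_eval G x y"
  "form_eval (F ^ n) x y = form_eval F x y ^ n"
  "form_eval (smult [:c:] F) x y = c * form_eval F x y"
  "form_eval (\<Sum>i\<in>A. g i) x y = (\<Sum>i\<in>A. form_eval (g i) x y)"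
  by (simp_all add: form_eval_def poly_sum)

text \<open>As a polynomial in \<open>y\<close> over the ring of polynomials in \<open>x\<close>,
  the difference would have all constants among its finitely many roots.\<close>

lemma form_eqI:
  assumes "\<And>x y. form_eval F x y = form_eval G x y"
  shows "F = G"
proof (rule ccontr)
  assume "F \<noteq> G"
  then have "finite {p. poly (F - G) p = 0}" by (intro poly_roots_finite) simp
  moreover have "range (\<lambda>y. [:y:]) \<subseteq> {p. poly (F - G) p = 0}"
    using assms by (auto simp: form_eval_def fun_eq_iff simp flip: poly_eq_poly_eq_iff)
  moreover have "infinite (range (\<lambda>y :: complex. [:y:]))"
    by (simp add: finite_image_iff inj_on_def infinite_UNIV_char_0)
  ultimately show False using finite_subset by blast
qed

lemma binary_form_expand:
  assumes "F \<in> binary_forms n"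
  shows "F = (\<Sum>i\<le>n. monom (monom (coeff (coeff F (n - i)) i) i) (n - i))"
proof (rule poly_eqI, rule poly_eqI)
  fix j i
  have "coeff (coeff (\<Sum>i\<le>n. monom (monom (coeff (coeff F (n - i)) i) i) (n - i)) j) i =
      (\<Sum>k\<le>n. if k = i then if n - i = j then coeff (coeff F j) i else 0 else 0)"
    unfolding coeff_sum by (intro sum.cong) (auto simp: coeff_monom)
  also have "\<dots> = coeff (coeff F j) i"
  proof -
    have "coeff (coeff F j) i = 0 \<or> i + j = n" using assms by (auto simp: binary_forms_def)
    then show ?thesis by auto
  qed
  finally show "coeff (coeff F j) i =
      coeff (coeff (\<Sum>i\<le>n. monom (monom (coeff (coeff F (n - i)) i) i) (n - i)) j) i" by simp
qed

lemma form_eval_expand: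
  assumes "F \<in> binary_forms n"
  shows "form_eval F x y = (\<Sum>i\<le>n. coeff (coeff F (n - i)) i * x ^ i * y ^ (n - i))"
  by (subst binary_form_expand[OF assms])
    (simp, simp add: form_eval_def poly_monom poly_const_pow mult_ac)

lemma form_eval_scale:
  assumes "F \<in> binary_forms n"
  shows "form_eval F (c * x) (c * y) = c ^ n * form_eval F x y"
  unfolding form_eval_expand[OF assms] sum_distrib_left
proof (intro sum.cong refl)
  fix i assume "i \<in> {..n}"
  then have "c ^ n = c ^ i * c ^ (n - i)" by (simp flip: power_add)
  then show "coeff (coeff F (n - i)) i * (c * x) ^ i * (c * y) ^ (n - i) =
      c ^ n * (coeff (coeff F (n - i)) i * x ^ i * y ^ (n - i))"
    by (simp add: power_mult_distrib)
qed

lemma binary_forms_zero: "0 \<in> binary_forms n"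
  by (simp add: binary_forms_def)

lemma binary_forms_add:
  "F \<in> binary_forms n \<Longrightarrow> G \<in> binary_forms n \<Longrightarrow> F + G \<in> binary_forms n"
  unfolding binary_forms_def by (auto, metis add.right_neutral)

lemma binary_forms_sum:
  "(\<And>i. i \<in> A \<Longrightarrow> g i \<in> binary_forms n) \<Longrightarrow> (\<Sum>i\<in>A. g i) \<in> binary_forms n"
  by (induction A rule: infinite_finite_induct) (auto simp: binary_forms_zero binary_forms_add)

lemma binary_forms_smult: "F \<in> binary_forms n \<Longrightarrow> smult [:c:] F \<in> binary_forms n"
  by (auto simp: binary_forms_def)

lemma binary_forms_mult:
  assumes "F \<in> binary_forms m" "G \<in> binary_forms n"
  shows "F * G \<in> binary_forms (m + n)"
  unfolding binary_forms_def
proof (intro CollectI allI impI)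
  fix i j
  assume "coeff (coeff (F * G) j) i \<noteq> 0"
  then obtain k where k: "k \<le> j" "coeff (coeff F k * coeff G (j - k)) i \<noteq> 0"
    unfolding coeff_mult[of F] coeff_sum by (metis (mono_tags, lifting) atMost_iff sum.neutral)
  then obtain l where "l \<le> i" "coeff (coeff F k) l * coeff (coeff G (j - k)) (i - l) \<noteq> 0"
    unfolding coeff_mult by (metis (mono_tags, lifting) atMost_iff sum.neutral)
  with k have "l + k = m" "(i - l) + (j - k) = n"
    using assms by (auto simp: binary_forms_def)
  with k \<open>l \<le> i\<close> show "i + j = m + n" by auto
qed

lemma binary_forms_power: "F \<in> binary_forms m \<Longrightarrow> F ^ k \<in> binary_forms (m * k)"
proof (induction k)
  case 0
  show ?case by (auto simp: binary_forms_def one_pCons coeff_pCons split: nat.splits if_splits)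
next
  case (Suc k)
  then show ?case using binary_forms_mult[of F m "F ^ k" "m * k"] by simp
qed

section \<open>Linear forms and coordinates adapted to a root\<close>

definition linear_form :: "complex \<Rightarrow> complex \<Rightarrow> complex poly poly" where
  "linear_form p q = [:[:0, p:], [:q:]:]"

lemma form_eval_linear_form [simp]: "form_eval (linear_form p q) x y = p * x + q * y"
  by (simp add: linear_form_def form_eval_def)

lemma linear_form_in_binary_forms: "linear_form p q \<in> binary_forms 1"
  by (auto simp: linear_form_def binary_forms_def coeff_pCons split: nat.splits)

lemma point_factor_eq: "point_factor a b = linear_form b (- a)"
  by (simp add: point_factor_def linear_form_def)

lemma binary_forms_1_cases:
  assumes "F \<in> binary_forms 1"
  obtains p q where "F = linear_form p q"
proof
  show "F = linear_form (coeff (coeff F 0) 1) (coeff (coeff F 1) 0)"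
    by (rule form_eqI) (simp add: form_eval_expand[OF assms])
qed

text \<open>Linear coordinates adapted to the point \<open>[a : b]\<close>: the linear factor \<open>l\<close> of that point and
  a complementary linear form \<open>k\<close>. Restricting a form to the affine line \<open>k = 1\<close> with
  parameter \<open>l\<close> loses no information.\<close>
locale adapted_coordinates =
  fixes a b a' b' :: complex
  assumes unimodular: "a * a' + b * b' = 1"
begin

definition l :: "complex poly poly" where "l = linear_form b (- a)"
definition k :: "complex poly poly" where "k = linear_form a' b'"

text \<open>The line \<open>k = 1\<close> is parametrized by
  \<open>(a + b' * t, b - a' * t)\<close>; unimodularity gives \<open>l\<close> the value
  \<open>t\<close> there. The composition substitutes for \<open>x\<close>, the outer evaluation for
  \<open>y\<close>.\<close>

definition restrict :: "complex poly poly \<Rightarrow> complex poly" where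
  "restrict F = poly (map_poly (\<lambda>p. pcompose p [:a, b':]) F) [:b, - a':]"

text \<open>Dividing by the binomial coefficient turns the power of
  \<open>\<alpha> * l + \<beta> * k\<close> into the sequence
  \<open>\<alpha> ^ (n - i) * \<beta> ^ i\<close>.\<close>

definition coord :: "nat \<Rightarrow> complex poly poly \<Rightarrow> nat \<Rightarrow> complex" where
  "coord n F i = coeff (restrict F) (n - i) / of_nat (n choose i)"

definition form_of :: "nat \<Rightarrow> (nat \<Rightarrow> complex) \<Rightarrow> complex poly poly" where
  "form_of n v = (\<Sum>i\<le>n. smult [:of_nat (n choose i) * v i:] (l ^ (n - i) * k ^ i))"

lemma poly_restrict: "poly (restrict F) t = form_eval F (a + b' * t) (b - a' * t)"
proof (induction F)
  case (pCons p F)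
  then show ?case
    by (simp add: restrict_def form_eval_def map_poly_pCons poly_pcompose algebra_simps)
qed (simp add: restrict_def)

lemma restrict_mult: "restrict (F * G) = restrict F * restrict G"
  by (simp add: poly_restrict fun_eq_iff flip: poly_eq_poly_eq_iff)

lemma restrict_power: "restrict (F ^ m) = restrict F ^ m"
  by (simp add: poly_restrict fun_eq_iff flip: poly_eq_poly_eq_iff)

lemma restrict_l: "restrict l = monom 1 1"
proof -
  have "poly (restrict l) t = (a * a' + b * b') * t" for t
    by (simp add: poly_restrict l_def algebra_simps)
  then show ?thesis
    by (simp add: unimodular poly_monom fun_eq_iff flip: poly_eq_poly_eq_iff)
qed

lemma restrict_expand:
  assumes "F \<in> binary_forms n"
  shows "restrict F =
    (\<Sum>i\<le>n. smult (coeff (coeff F (n - i)) i) ([:a, b':] ^ i * [:b, - a':] ^ (n - i)))"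
proof -
  have "poly (restrict F) t = poly (\<Sum>i\<le>n. smult (coeff (coeff F (n - i)) i)
      ([:a, b':] ^ i * [:b, - a':] ^ (n - i))) t" for t
    by (simp add: poly_restrict form_eval_expand[OF assms] poly_sum algebra_simps)
  then show ?thesis by (simp add: fun_eq_iff flip: poly_eq_poly_eq_iff)
qed

lemma degree_restrict:
  assumes "F \<in> binary_forms n"
  shows "degree (restrict F) \<le> n"
  unfolding restrict_expand[OF assms]
proof (intro degree_sum_le order.trans[OF degree_smult_le])
  fix i assume "i \<in> {..n}"
  have "degree ([:a, b':] ^ i * [:b, - a':] ^ (n - i)) \<le>
      degree [:a, b':] * i + degree [:b, - a':] * (n - i)"
    by (intro order.trans[OF degree_mult_le] add_mono degree_power_le)
  also have "\<dots> \<le> 1 * i + 1 * (n - i)"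
    by (intro add_mono mult_right_mono) simp_all
  finally show "degree ([:a, b':] ^ i * [:b, - a':] ^ (n - i)) \<le> n"
    using \<open>i \<in> {..n}\<close> by simp
qed simp

lemma form_of_in_binary_forms: "form_of n v \<in> binary_forms n"
  unfolding form_of_def
proof (intro binary_forms_sum binary_forms_smult)
  fix i assume "i \<in> {..n}"
  have "l ^ (n - i) * k ^ i \<in> binary_forms (1 * (n - i) + 1 * i)"
    unfolding l_def k_def
    by (intro binary_forms_mult binary_forms_power linear_form_in_binary_forms)
  then show "l ^ (n - i) * k ^ i \<in> binary_forms n" using \<open>i \<in> {..n}\<close> by simp
qed

text \<open>Where \<open>k\<close> is nonzero, homogeneity rescales a point onto the line
  \<open>k = 1\<close>, with parameter \<open>L / K\<close>.\<close>

lemma form_of_coord: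
  assumes "F \<in> binary_forms n"
  shows "form_of n (coord n F) = F"
proof -
  have eval: "form_eval (form_of n (coord n F)) x y = form_eval F x y"
    if K: "a' * x + b' * y \<noteq> 0" for x y
  proof -
    define L where "L = b * x - a * y"
    define K where "K = a' * x + b' * y"
    have "form_eval (form_of n (coord n F)) x y =
        (\<Sum>i\<le>n. coeff (restrict F) (n - i) * L ^ (n - i) * K ^ i)"
      unfolding form_of_def by (auto simp: coord_def l_def k_def L_def K_def intro!: sum.cong)
    also have "\<dots> = hom_eval n (restrict F) K L"
      unfolding hom_eval_def
      by (rule sum.reindex_bij_witness[of _ "\<lambda>i. n - i" "\<lambda>i. n - i"]) auto
    also have "\<dots> = K ^ n * form_eval F (a + b' * (L / K)) (b - a' * (L / K))"
      using K by (subst hom_eval_nonzero) (simp_all add: K_def poly_restrict degree_restrict[OF assms])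
    also have "\<dots> = form_eval F (K * (a + b' * (L / K))) (K * (b - a' * (L / K)))"
      by (rule form_eval_scale[OF assms, symmetric])
    also have "K * (a + b' * (L / K)) = (a * a' + b * b') * x"
      using K by (simp add: K_def[symmetric] distrib_left) (simp add: K_def L_def algebra_simps)
    also have "K * (b - a' * (L / K)) = (a * a' + b * b') * y"
      using K by (simp add: K_def[symmetric] right_diff_distrib) (simp add: K_def L_def algebra_simps)
    finally show ?thesis by (simp add: unimodular)
  qed
  \<comment> \<open>Multiplying by \<open>k\<close> removes the exception on the zero set of
    \<open>k\<close>; then \<open>k\<close> is cancelled.\<close>
  have "k * form_of n (coord n F) = k * F"
    by (rule form_eqI) (use eval in \<open>auto simp: k_def\<close>)
  moreover have "k \<noteq> 0"
    using unimodular by (auto simp: k_def linear_form_def)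
  ultimately show ?thesis by simp
qed

lemma waring_decomposable_iff:
  assumes F: "F \<in> binary_forms n"
  shows "waring_decomposable n F r \<longleftrightarrow> power_sum n r (coord n F)"
proof
  assume "waring_decomposable n F r"
  then obtain g where g: "\<And>j. j < r \<Longrightarrow> g j \<in> binary_forms 1" and Fg: "F = (\<Sum>j<r. g j ^ n)"
    unfolding waring_decomposable_def by blast
  from g have "\<exists>p q. g j = linear_form p q" if "j < r" for j
    using that binary_forms_1_cases by metis
  then obtain p q where pq: "\<And>j. j < r \<Longrightarrow> g j = linear_form (p j) (q j)" by metis
  \<comment> \<open>\<open>\<alpha> j\<close> and \<open>\<beta> j\<close> are the coefficients of
    the linear form \<open>g j\<close> in the basis \<open>l\<close>, \<open>k\<close>.\<close>
  define \<alpha> where "\<alpha> = (\<lambda>j. p j * b' - q j * a')"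
  define \<beta> where "\<beta> = (\<lambda>j. p j * a + q j * b)"
  have "poly (restrict F) t = poly (\<Sum>j<r. [:\<beta> j, \<alpha> j:] ^ n) t" for t
  proof -
    have "poly (restrict F) t = (\<Sum>j<r. (p j * (a + b' * t) + q j * (b - a' * t)) ^ n)"
      unfolding poly_restrict Fg by (simp add: pq)
    also have "\<dots> = (\<Sum>j<r. (\<beta> j + t * \<alpha> j) ^ n)"
      by (simp add: \<alpha>_def \<beta>_def algebra_simps)
    finally show ?thesis by (simp add: poly_sum)
  qed
  then have "restrict F = (\<Sum>j<r. [:\<beta> j, \<alpha> j:] ^ n)"
    by (simp add: fun_eq_iff flip: poly_eq_poly_eq_iff)
  moreover have "coeff ([:\<beta> j, \<alpha> j:] ^ n) (n - i) = of_nat (n choose i) * (\<alpha> j ^ (n - i) * \<beta> j ^ i)"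
    if "i \<le> n" for i j
    using that binomial_symmetric[OF that] by (subst coeff_linear_poly_power) (simp_all add: mult.assoc)
  ultimately have "coord n F i = (\<Sum>j<r. \<alpha> j ^ (n - i) * \<beta> j ^ i)" if "i \<le> n" for i
    using that by (simp add: coord_def coeff_sum flip: sum_distrib_left)
  then show "power_sum n r (coord n F)"
    unfolding power_sum_def by (intro exI[of _ \<alpha>] exI[of _ \<beta>] allI impI)
next
  assume "power_sum n r (coord n F)"
  then obtain \<alpha> \<beta> where v: "\<And>i. i \<le> n \<Longrightarrow> coord n F i = (\<Sum>j<r. \<alpha> j ^ (n - i) * \<beta> j ^ i)"
    unfolding power_sum_def by blast
  define g where "g = (\<lambda>j. linear_form (\<alpha> j * b + \<beta> j * a') (\<beta> j * b' - \<alpha> j * a))"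
  have "form_of n (coord n F) = (\<Sum>j<r. g j ^ n)"
  proof (rule form_eqI)
    fix x y
    define L where "L = b * x - a * y"
    define K where "K = a' * x + b' * y"
    have "form_eval (form_of n (coord n F)) x y =
        (\<Sum>i\<le>n. \<Sum>j<r. of_nat (n choose i) * (\<beta> j * K) ^ i * (\<alpha> j * L) ^ (n - i))"
      unfolding form_of_def
      by (auto simp: v l_def k_def L_def K_def sum_distrib_left sum_distrib_right
          power_mult_distrib mult_ac intro!: sum.cong)
    also have "\<dots> = (\<Sum>j<r. (\<beta> j * K + \<alpha> j * L) ^ n)"
      unfolding binomial_ring by (rule sum.swap)
    also have "\<dots> = form_eval (\<Sum>j<r. g j ^ n) x y"
      by (simp add: g_def L_def K_def algebra_simps)
    finally show "form_eval (form_of n (coord n F)) x y = form_eval (\<Sum>j<r. g j ^ n) x y" .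
  qed
  then have "F = (\<Sum>j<r. g j ^ n)" by (simp add: form_of_coord[OF F])
  then show "waring_decomposable n F r"
    unfolding waring_decomposable_def
    using linear_form_in_binary_forms by (intro exI[of _ g]) (auto simp: g_def)
qed

lemma coord_form_of:
  assumes "i \<le> n"
  shows "coord n (form_of n v) i = v i"
proof -
  have "restrict k = 1"
  proof -
    have "poly (restrict k) t = a * a' + b * b'" for t
      by (simp add: poly_restrict k_def algebra_simps)
    then show ?thesis by (simp add: unimodular fun_eq_iff flip: poly_eq_poly_eq_iff)
  qed
  then have k: "form_eval k (a + b' * t) (b - a' * t) = 1" for t
    using poly_restrict[of k t] by simp
  have l: "form_eval l (a + b' * t) (b - a' * t) = t" for t
    using poly_restrict[of l t] by (simp add: restrict_l poly_monom)
  have "poly (restrict (form_of n v)) t =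
      poly (\<Sum>i\<le>n. monom (of_nat (n choose i) * v i) (n - i)) t" for t
    by (simp add: poly_restrict form_of_def k l poly_sum poly_monom)
  then have restrict: "restrict (form_of n v) = (\<Sum>i\<le>n. monom (of_nat (n choose i) * v i) (n - i))"
    by (simp add: fun_eq_iff flip: poly_eq_poly_eq_iff)
  have "coeff (restrict (form_of n v)) (n - i) =
      (\<Sum>j\<le>n. if j = i then of_nat (n choose i) * v i else 0)"
    unfolding restrict coeff_sum using assms by (intro sum.cong) (auto simp: coeff_monom)
  then show ?thesis using assms by (simp add: coord_def)
qed

lemma not_is_unit_l: "\<not> is_unit l"
proof
  assume "is_unit l"
  then obtain G where "1 = l * G" by (elim dvdE)
  have "form_eval (l * G) a b = 0" by (simp add: l_def)
  then show False unfolding \<open>1 = l * G\<close>[symmetric] by (simp add: form_eval_def)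
qed

text \<open>Restriction sends \<open>l ^ m\<close> to \<open>t ^ m\<close>, so divisibility kills
  the coefficients below \<open>m\<close>. Conversely, every remaining term contains
  \<open>l ^ (n - i)\<close> with \<open>n - i \<ge> m\<close>.\<close>

lemma power_l_dvd_iff:
  assumes F: "F \<in> binary_forms n"
  shows "l ^ m dvd F \<longleftrightarrow> (\<forall>i. i \<le> n \<longrightarrow> n < i + m \<longrightarrow> coord n F i = 0)"
proof
  assume "l ^ m dvd F"
  then obtain G where "F = l ^ m * G" by (elim dvdE)
  then have "restrict F = monom 1 m * restrict G"
    by (simp add: restrict_mult restrict_power restrict_l monom_power)
  then show "\<forall>i. i \<le> n \<longrightarrow> n < i + m \<longrightarrow> coord n F i = 0"
    by (auto simp: coord_def coeff_monom_mult)
next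
  assume zero: "\<forall>i. i \<le> n \<longrightarrow> n < i + m \<longrightarrow> coord n F i = 0"
  have "l ^ m dvd form_of n (coord n F)"
    unfolding form_of_def
  proof (rule dvd_sum)
    fix i assume "i \<in> {..n}"
    then show "l ^ m dvd smult [:of_nat (n choose i) * coord n F i:] (l ^ (n - i) * k ^ i)"
      using zero by (cases "n < i + m") (auto intro!: dvd_smult dvd_mult2 le_imp_power_dvd)
  qed
  then show "l ^ m dvd F" by (simp add: form_of_coord[OF F])
qed

lemma multiplicity_coord:
  assumes F: "F \<in> binary_forms n" "F \<noteq> 0"
  shows "multiplicity l F \<le> n"
    and "coord n F (n - multiplicity l F) \<noteq> 0"
    and "\<And>i. n - multiplicity l F < i \<Longrightarrow> i \<le> n \<Longrightarrow> coord n F i = 0"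
proof -
  define m where "m = multiplicity l F"
  have dvd_iff: "l ^ j dvd F \<longleftrightarrow> j \<le> m" for j
    unfolding m_def using F(2) not_is_unit_l by (rule power_dvd_iff_le_multiplicity)
  have zero: "coord n F i = 0" if "i \<le> n" "n < i + m" for i
    using dvd_iff[of m] that power_l_dvd_iff[OF F(1), of m] by simp
  have "m \<le> n"
  proof (rule ccontr)
    assume "\<not> m \<le> n"
    then have "form_of n (coord n F) = 0"
      unfolding form_of_def by (intro sum.neutral) (simp add: zero)
    then show False using F by (simp add: form_of_coord)
  qed
  moreover have "coord n F (n - m) \<noteq> 0"
  proof
    assume 0: "coord n F (n - m) = 0"
    have "coord n F i = 0" if "i \<le> n" "n < i + Suc m" for i
    proof (cases "i = n - m")
      case False
      with that \<open>m \<le> n\<close> show ?thesis by (intro zero) auto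
    qed (simp add: 0)
    then have "l ^ Suc m dvd F" using power_l_dvd_iff[OF F(1), of "Suc m"] by blast
    then show False unfolding dvd_iff by simp
  qed
  ultimately show "multiplicity l F \<le> n" "coord n F (n - multiplicity l F) \<noteq> 0"
    "\<And>i. n - multiplicity l F < i \<Longrightarrow> i \<le> n \<Longrightarrow> coord n F i = 0"
    by (auto simp: m_def[symmetric] intro: zero)
qed

end

subsection \<open>Rank and border rank\<close>

abbreviation coeffs2 :: "complex poly poly \<Rightarrow> nat \<Rightarrow> nat \<Rightarrow> complex" where
  "coeffs2 F \<equiv> \<lambda>j i. coeff (coeff F j) i"

lemma in_form_closure_iff:
  "F \<in> form_topology n closure_of S \<longleftrightarrow> F \<in> binary_forms n \<and>
    (\<forall>U. open U \<longrightarrow> coeffs2 F \<in> U \<longrightarrow> (\<exists>G\<in>S \<inter> binary_forms n. coeffs2 G \<in> U))"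
proof -
  have "(\<forall>T. F \<in> T \<and> openin (form_topology n) T \<longrightarrow> (\<exists>G. G \<in> S \<and> G \<in> T)) \<longleftrightarrow>
      (\<forall>U. open U \<longrightarrow> coeffs2 F \<in> U \<longrightarrow> (\<exists>G\<in>S \<inter> binary_forms n. coeffs2 G \<in> U))"
    if "F \<in> binary_forms n"
    using that unfolding form_topology_def openin_pullback_topology open_openin[symmetric] by blast
  then show ?thesis
    unfolding in_closure_of by (auto simp: form_topology_def topspace_pullback_topology)
qed

text \<open>Continuous equations persist in the closure; this turns the Hankel determinant into a
  lower bound for border rank.\<close>

lemma form_closure_vanishing:
  assumes "F \<in> form_topology n closure_of S" "continuous_on UNIV h"
    and "\<And>G. G \<in> S \<Longrightarrow> G \<in> binary_forms n \<Longrightarrow> h (coeffs2 G) = (0 :: complex)"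
  shows "h (coeffs2 F) = 0"
proof (rule ccontr)
  assume "h (coeffs2 F) \<noteq> 0"
  moreover have "open (h -` (- {0}))"
    using assms(2) by (intro open_vimage) auto
  ultimately obtain G where "G \<in> S \<inter> binary_forms n" "coeffs2 G \<in> h -` (- {0})"
    using assms(1) unfolding in_form_closure_iff by blast
  then show False using assms(3) by auto
qed

lemma form_closure_path:
  fixes g :: "complex \<Rightarrow> complex poly poly"
  assumes cont: "\<And>i j. continuous_on UNIV (\<lambda>t. coeff (coeff (g t) j) i)"
    and g: "\<And>t. g t \<in> binary_forms n" "\<And>t. t \<noteq> 0 \<Longrightarrow> g t \<in> S"
  shows "g 0 \<in> form_topology n closure_of S"
  unfolding in_form_closure_iff
proof (intro conjI allI impI)
  fix U :: "(nat \<Rightarrow> nat \<Rightarrow> complex) set"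
  assume "open U" "coeffs2 (g 0) \<in> U"
  have "continuous_on UNIV (\<lambda>t. coeffs2 (g t))"
    by (intro continuous_on_coordinatewise_then_product cont)
  then have vimage: "open ((\<lambda>t. coeffs2 (g t)) -` U)"
    using \<open>open U\<close> by (intro open_vimage)
  obtain e where "e > 0" and e: "ball 0 e \<subseteq> (\<lambda>t. coeffs2 (g t)) -` U"
    using openE[OF vimage vimageI2] \<open>coeffs2 (g 0) \<in> U\<close> by metis
  have "complex_of_real (e / 2) \<in> ball 0 e" using \<open>e > 0\<close> by simp
  with e have "coeffs2 (g (complex_of_real (e / 2))) \<in> U" by blast
  moreover have "g (complex_of_real (e / 2)) \<in> S" using \<open>e > 0\<close> by (intro g) simp
  ultimately show "\<exists>G\<in>S \<inter> binary_forms n. coeffs2 G \<in> U" using g(1) by blast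
qed (rule g(1))

context adapted_coordinates
begin

text \<open>The coordinates are linear in finitely many coefficients, so they extend continuously to
  the whole product space from which the topology of forms is pulled back.\<close>

lemma continuous_coord:
  obtains H :: "(nat \<Rightarrow> nat \<Rightarrow> complex) \<Rightarrow> nat \<Rightarrow> complex" where
    "\<And>i. continuous_on UNIV (\<lambda>c. H c i)"
    "\<And>F. F \<in> binary_forms n \<Longrightarrow> coord n F = H (coeffs2 F)"
proof
  define H :: "(nat \<Rightarrow> nat \<Rightarrow> complex) \<Rightarrow> nat \<Rightarrow> complex" where
    "H = (\<lambda>c i. (\<Sum>k\<le>n. c (n - k) k * coeff ([:a, b':] ^ k * [:b, - a':] ^ (n - k)) (n - i)) /
      of_nat (n choose i))"
  have "continuous_on UNIV (\<lambda>c :: nat \<Rightarrow> nat \<Rightarrow> complex. c j i)" for i j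
    by (rule continuous_on_product_then_coordinatewise)
      (rule continuous_on_product_coordinates)
  then show "continuous_on UNIV (\<lambda>c. H c i)" for i
    unfolding H_def divide_inverse by (intro continuous_intros)
  show "coord n F = H (coeffs2 F)" if "F \<in> binary_forms n" for F
    by (rule ext) (simp add: coord_def restrict_expand[OF that] coeff_sum H_def)
qed

lemma waring_rank_eq:
  assumes "F \<in> binary_forms n" "0 < e" "2 * e \<le> n" "coord n F e \<noteq> 0"
    and "\<And>i. e < i \<Longrightarrow> i \<le> n \<Longrightarrow> coord n F i = 0"
  shows "waring_rank n F = Suc n - e"
  unfolding waring_rank_def waring_decomposable_iff[OF assms(1)]
proof (rule Least_equality)
  show "power_sum n (Suc n - e) (coord n F)"
    using assms by (intro power_sum_upper_bound) auto
  show "Suc n - e \<le> r" if "power_sum n r (coord n F)" for r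
    using power_sum_lower_bound[OF that, of e] assms by auto
qed

lemma waring_decomposable_waring_rank:
  assumes "F \<in> binary_forms n" "n > 0"
  shows "waring_decomposable n F (waring_rank n F)"
  unfolding waring_rank_def
proof (rule LeastI)
  show "waring_decomposable n F (Suc n)"
    using assms by (simp add: waring_decomposable_iff power_sum_exists)
qed

lemma border_rank_eq:
  assumes F: "F \<in> binary_forms n" and "0 < n" "2 * e \<le> n" "coord n F e \<noteq> 0"
    and zero: "\<And>i. e < i \<Longrightarrow> i \<le> n \<Longrightarrow> coord n F i = 0"
  shows "border_rank n F = Suc e"
proof -
  \<comment> \<open>Border rank refers to forms of rank exactly \<open>r\<close> (\<open>S\<close>),
    whereas the determinant and the interpolation handle at most \<open>r\<close> powers
    (\<open>D\<close>).\<close>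
  define S where "S = (\<lambda>r. {G \<in> binary_forms n. G \<noteq> 0 \<and> waring_rank n G = r})"
  define D where "D = (\<lambda>r. {G \<in> binary_forms n. waring_decomposable n G r})"
  have D_mono: "D r \<subseteq> D r'" if "r \<le> r'" for r r'
    using that \<open>0 < n\<close> power_sum_mono unfolding D_def by (auto simp: waring_decomposable_iff)
  have S_le: "S r \<subseteq> D r" for r
    unfolding S_def D_def using waring_decomposable_waring_rank \<open>0 < n\<close> by blast
  have lower: "F \<notin> form_topology n closure_of D e"
  proof
    assume closure: "F \<in> form_topology n closure_of D e"
    obtain H where H: "\<And>i. continuous_on UNIV (\<lambda>c. H c i)"
      "\<And>F. F \<in> binary_forms n \<Longrightarrow> coord n F = H (coeffs2 F)"
      using continuous_coord[of n] by metis
    have "hankel_det (Suc e) (H (coeffs2 G)) = 0" if "G \<in> D e" "G \<in> binary_forms n" for G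
      using that \<open>2 * e \<le> n\<close> hankel_det_power_sum[of n e "coord n G" e]
      by (simp add: D_def waring_decomposable_iff H(2))
    with closure continuous_on_hankel_det[OF H(1)] have "hankel_det (Suc e) (H (coeffs2 F)) = 0"
      by (rule form_closure_vanishing)
    moreover have "hankel_det (Suc e) (coord n F) \<noteq> 0"
      using assms by (intro hankel_det_triangular) auto
    ultimately show False by (simp add: H(2)[OF F])
  qed
  have "F \<in> form_topology n closure_of D (Suc e)"
  proof -
    obtain g :: "complex \<Rightarrow> nat \<Rightarrow> complex" where
      g: "\<And>i. continuous_on UNIV (\<lambda>t. g t i)" "\<And>i. i \<le> n \<Longrightarrow> g 0 i = coord n F i"
      "\<And>t. t \<noteq> 0 \<Longrightarrow> power_sum n (Suc e) (g t)"
    proof (rule power_sum_degeneration[where v = "coord n F", OF \<open>0 < n\<close> zero])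
      fix g :: "complex \<Rightarrow> nat \<Rightarrow> complex"
      assume "\<And>i. continuous_on UNIV (\<lambda>t. g t i)" "\<And>i. i \<le> n \<Longrightarrow> g 0 i = coord n F i"
        "\<And>t. t \<noteq> 0 \<Longrightarrow> power_sum n (Suc e) (g t)"
      then show thesis by (rule that[of g])
    qed
    have "form_of n (g 0) \<in> form_topology n closure_of D (Suc e)"
    proof (rule form_closure_path)
      show "continuous_on UNIV (\<lambda>t. coeff (coeff (form_of n (g t)) j) i)" for i j
      proof -
        have "coeff (coeff (form_of n v) j) i = (\<Sum>r\<le>n. of_nat (n choose r) * v r *
            coeff (coeff (l ^ (n - r) * k ^ r) j) i)" for v
          by (simp add: form_of_def coeff_sum)
        then show ?thesis
          by (simp only:) (intro continuous_on_sum continuous_on_mult continuous_on_const g(1))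
      qed
      show "form_of n (g t) \<in> D (Suc e)" if "t \<noteq> 0" for t
      proof -
        have "power_sum n (Suc e) (coord n (form_of n (g t)))"
          using g(3)[OF that] by (simp add: power_sum_def coord_form_of)
        then show ?thesis by (simp add: D_def form_of_in_binary_forms waring_decomposable_iff)
      qed
    qed (rule form_of_in_binary_forms)
    moreover have "form_of n (g 0) = form_of n (coord n F)"
      by (simp add: form_of_def g(2))
    ultimately show ?thesis by (simp add: form_of_coord[OF F])
  qed
  \<comment> \<open>The passage from \<open>D\<close> to \<open>S\<close>: closure commutes with
    finite unions, and \<open>F\<close> is not in the closure of \<open>D e\<close>, so it must be
    in that of \<open>S (Suc e)\<close>. The zero form, excluded from \<open>S\<close>, already lies
    in \<open>D e\<close>.\<close>
  moreover have "D (Suc e) \<subseteq> S (Suc e) \<union> D e"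
  proof
    fix G assume G: "G \<in> D (Suc e)"
    show "G \<in> S (Suc e) \<union> D e"
    proof (cases "G \<in> D e")
      case False
      have "waring_rank n G = Suc e"
        unfolding waring_rank_def
      proof (rule Least_equality)
        show "waring_decomposable n G (Suc e)" using G by (simp add: D_def)
        show "Suc e \<le> r" if "waring_decomposable n G r" for r
        proof (rule ccontr)
          assume "\<not> Suc e \<le> r"
          moreover have "G \<in> D r" using G that by (simp add: D_def)
          ultimately show False using False D_mono[of r e] by auto
        qed
      qed
      moreover have "0 \<in> D 0" by (simp add: D_def binary_forms_zero waring_decomposable_def)
      then have "G \<noteq> 0" using False D_mono[of 0 e] by auto
      ultimately show ?thesis using G by (simp add: S_def D_def)
    qed simp
  qed
  ultimately have upper: "F \<in> form_topology n closure_of S (Suc e)"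
    using lower closure_of_mono[of "D (Suc e)" "S (Suc e) \<union> D e" "form_topology n"] by auto
  have "border_rank n F = (LEAST r. F \<in> form_topology n closure_of S r)"
    by (simp add: border_rank_def S_def)
  also have "\<dots> = Suc e"
  proof (rule Least_equality)
    show "F \<in> form_topology n closure_of S (Suc e)" by (rule upper)
  next
    fix r assume r: "F \<in> form_topology n closure_of S r"
    show "Suc e \<le> r"
    proof (rule ccontr)
      assume "\<not> Suc e \<le> r"
      then have "S r \<subseteq> D e" using S_le[of r] D_mono[of r e] by auto
      with r lower closure_of_mono[of "S r" "D e" "form_topology n"] show False by blast
    qed
  qed
  finally show ?thesis .
qed

end

section \<open>Roots of maximal multiplicity and the final result\<close>

lemma adapted_coordinates_exist:
  assumes "(a, b) \<noteq> (0, 0)"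
  obtains a' b' where "adapted_coordinates a b a' b'"
proof (cases "a = 0")
  case True
  with assms show ?thesis by (intro that[of 0 "1 / b"]) (simp add: adapted_coordinates_def)
next
  case False
  then show ?thesis by (intro that[of "1 / a" 0]) (simp add: adapted_coordinates_def)
qed

text \<open>If [1 : 0] is not a root, setting \<open>y = 1\<close> yields a polynomial with nonzero
  coefficient at the positive degree \<open>n\<close>, which has a complex root.\<close>

lemma form_has_root:
  assumes F: "F \<in> binary_forms n" and "0 < n"
  shows "\<exists>a b. (a, b) \<noteq> (0, 0) \<and> form_eval F a b = 0"
proof (cases "form_eval F 1 0 = 0")
  case False
  define p where "p = (\<Sum>i\<le>n. monom (coeff (coeff F (n - i)) i) i)"
  have "form_eval F 1 0 = coeff p n"
    unfolding form_eval_expand[OF F] p_def coeff_sum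
    by (intro sum.cong) (auto simp: power_0_left)
  with False have "coeff p n \<noteq> 0" by simp
  with \<open>0 < n\<close> have "degree p \<noteq> 0" by (metis le_degree le_zero_eq neq0_conv)
  then obtain x where "poly p x = 0"
    using fundamental_theorem_of_algebra[of p] by (auto simp: constant_degree)
  moreover have "poly p x = form_eval F x 1"
    unfolding form_eval_expand[OF F] p_def by (simp add: poly_sum poly_monom)
  ultimately show ?thesis by (intro exI[of _ x] exI[of _ 1]) simp
qed (intro exI[of _ 1] exI[of _ 0], simp)

text \<open>The set under \<open>Max\<close> is nonempty because a root exists, and finite because
  multiplicities are bounded by the degree.\<close>

lemma max_root_multiplicity_attained:
  assumes F: "F \<in> binary_forms n" "F \<noteq> 0" and "0 < n"
  obtains a b where "(a, b) \<noteq> (0, 0)" "multiplicity (point_factor a b) F = max_root_multiplicity F"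
proof -
  define M where "M = {multiplicity (point_factor a b) F | a b. (a, b) \<noteq> (0, 0) \<and> form_eval F a b = 0}"
  have "M \<subseteq> {..n}"
  proof
    fix m assume "m \<in> M"
    then obtain a b where m: "m = multiplicity (point_factor a b) F" and "(a, b) \<noteq> (0, 0)"
      unfolding M_def by blast
    then obtain a' b' where "adapted_coordinates a b a' b'"
      using adapted_coordinates_exist by metis
    then interpret adapted_coordinates a b a' b' .
    show "m \<in> {..n}"
      using multiplicity_coord(1)[OF F] unfolding m point_factor_eq l_def by simp
  qed
  moreover have "M \<noteq> {}"
    using form_has_root[OF F(1) \<open>0 < n\<close>] unfolding M_def by blast
  ultimately have "max_root_multiplicity F \<in> M"
    unfolding max_root_multiplicity_def M_def[symmetric]
    by (meson Max_in finite_atMost finite_subset)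
  then show ?thesis using that unfolding M_def by force
qed

theorem ranks_of_high_multiplicity:
  assumes F: "F \<in> binary_forms n" "F \<noteq> 0" and n: "0 < n" "n \<le> 2 * max_root_multiplicity F"
  shows "max_root_multiplicity F \<le> n"
    and "border_rank n F = Suc n - max_root_multiplicity F"
    and "waring_rank n F = (if max_root_multiplicity F = n then 1 else Suc (max_root_multiplicity F))"
proof -
  define m where "m = max_root_multiplicity F"
  obtain a b where "(a, b) \<noteq> (0, 0)" and m: "multiplicity (point_factor a b) F = m"
    using max_root_multiplicity_attained[OF F n(1)] unfolding m_def by metis
  then obtain a' b' where "adapted_coordinates a b a' b'"
    using adapted_coordinates_exist by metis
  then interpret adapted_coordinates a b a' b' .
  have l: "multiplicity l F = m" using m by (simp add: point_factor_eq l_def)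
  note coord = multiplicity_coord[OF F, unfolded l]
  have "border_rank n F = Suc (n - m)"
    using n coord unfolding m_def[symmetric] by (intro border_rank_eq[OF F(1)]) auto
  moreover have "waring_rank n F = (if m = n then 1 else Suc m)"
  proof (cases "m = n")
    case False
    with coord n show ?thesis
      using waring_rank_eq[OF F(1), of "n - m"] by (simp add: m_def[symmetric])
  next
    \<comment> \<open>Here \<open>e = 0\<close> and \<open>F\<close> is a multiple of
      \<open>l ^ n\<close>; an \<open>n\<close>-th root of the factor makes it a single
      power.\<close>
    case True
    obtain c where c: "coord n F 0 = c ^ n"
      using exists_complex_root[of n "coord n F 0"] n(1) by blast
    have "coord n F i = (\<Sum>j<(1 :: nat). c ^ (n - i) * 0 ^ i)" if "i \<le> n" for i
      using coord(3)[of i] c that True by (cases "i = 0") auto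
    then have "power_sum n 1 (coord n F)"
      unfolding power_sum_def by (intro exI[of _ "\<lambda>_. c"] exI[of _ "\<lambda>_. 0"] allI impI)
    then have "waring_decomposable n F 1" by (simp add: waring_decomposable_iff[OF F(1)])
    moreover have "1 \<le> r" if "waring_decomposable n F r" for r
      using that F(2) by (cases r) (auto simp: waring_decomposable_def)
    ultimately have "waring_rank n F = 1"
      unfolding waring_rank_def by (rule Least_equality)
    then show ?thesis using True by simp
  qed
  ultimately show "max_root_multiplicity F \<le> n"
    "border_rank n F = Suc n - max_root_multiplicity F"
    "waring_rank n F = (if max_root_multiplicity F = n then 1 else Suc (max_root_multiplicity F))"
    using coord(1) by (simp_all add: m_def[symmetric] Suc_diff_le)
qed

theorem corollary5p2:
  fixes f :: "complex poly poly" and m :: nat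
  assumes "f \<in> binary_forms 6"
    and "f \<noteq> 0"
    and "m = max_root_multiplicity f"
    and "m \<ge> 3"
  shows "(m = 6 \<longleftrightarrow> border_rank 6 f = 1) \<and>
    (m = 5 \<longrightarrow> border_rank 6 f = 2) \<and>
    (m = 4 \<longrightarrow> border_rank 6 f = 3) \<and>
    (m = 3 \<longrightarrow> border_rank 6 f = 4) \<and>
    (m \<in> {3, 6} \<longrightarrow> int (waring_rank 6 f) - int (border_rank 6 f) = 0) \<and>
    (m = 5 \<longrightarrow> int (waring_rank 6 f) - int (border_rank 6 f) = 4) \<and>
    (m = 4 \<longrightarrow> int (waring_rank 6 f) - int (border_rank 6 f) = 2)"
proof -
  \<comment> \<open>For \<open>m < 6\<close> the difference of the ranks is
    \<open>(m + 1) - (7 - m) = 2 * m - 6\<close>; for \<open>m = 6\<close> both are 1.\<close>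
  have "m \<le> 6" "border_rank 6 f = 7 - m" "waring_rank 6 f = (if m = 6 then 1 else Suc m)"
    using ranks_of_high_multiplicity[OF assms(1,2)] assms(3,4) by auto
  with \<open>m \<ge> 3\<close> show ?thesis by auto
qed

end
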